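(* Let $\{\mu^k\}_{k=0}^\infty$ be positive reals with $\mu^k\to+\infty$. For each $k$, let $z^k$ be a stationary point of $\mathcal{P}_{gap}(\mu^k)$, and assume that $z^k$ satisfies the second-order necessary condition of $\mathcal{P}_{gap}(\mu^k)$. Let $\bar z=[\bar x^T,\bar\lambda^T,\bar\eta^T]^T$ be a limit point of $\{z^k\}_{k=0}^\infty$. Assume that there exists a real number $M$ such that $|J(z^k)+\mu^k\varphi^{ab}(z^k)|\le M$ for all $k$, that the MPCC-LICQ holds at $\bar z$, and that the ULSC condition holds at $\bar z$. Then $\bar z$ is a strongly stationary point of the MPCC, that is, $\bar z$ is feasible for the MPCC and there exist Lagrangian multipliers $\bar u\in\mathbb{R}^{n_h}$, $\bar v,\bar w\in\mathbb{R}^{n_\lambda}$ such that $$\nabla_z J(\bar z)+\bar u^T\nabla_z h(\bar z)-\bar v^T\nabla_z\bar\lambda-\bar w^T\nabla_z\bar\eta=0,$$ $$\bar v_i\in\mathbb{R},\ \bar w_i=0,\quad i\in\mathcal{I}_\lambda(\bar z),$$ $$\bar v_i=0,\ \bar w_i\in\mathbb{R},\quad i\in\mathcal{I}_\eta(\bar z),$$ $$\bar v_i\ge 0,\ \bar w_i\ge 0,\quad i\in\mathcal{I}_{\lambda\eta}(\bar z).$$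
   Context: Notation: $\nabla_z f$ denotes the Jacobian of $f$ (row vector for scalar $f$); a function is $LC^k$ if its $k$-th derivative is Lipschitz continuous; $0\le x\perp y\ge0$ means $x\ge0$, $y\ge0$ componentwise and $x^Ty=0$; $\max$ of vectors is componentwise; a limit point of a sequence is the limit of some subsequence. MPCC: with $z=[x^T,\lambda^T,\eta^T]^T\in\mathbb{R}^{n_x+2n_\lambda}$, $x\in\mathbb{R}^{n_x}$, $\lambda,\eta\in\mathbb{R}^{n_\lambda}$, the mathematical program with complementarity constraints (MPCC) is $$\min_{x,\lambda,\eta} J(x,\lambda,\eta)\quad\text{s.t.}\quad h(x,\lambda,\eta)=0,\quad 0\le\lambda\perp\eta\ge0,$$ where $J:\mathbb{R}^{n_x}\times\mathbb{R}^{n_\lambda}\times\mathbb{R}^{n_\lambda}\to\mathbb{R}$ and $h:\mathbb{R}^{n_x}\times\mathbb{R}^{n_\lambda}\times\mathbb{R}^{n_\lambda}\to\mathbb{R}^{n_h}$ are $LC^2$. A point is feasible if it satisfies all these constraints. $\nabla_z\lambda$, $\nabla_z\eta$ (rows $\nabla_z\lambda_i$, $\nabla_z\eta_i$) are the constant Jacobians of the coordinate maps $z\mapsto\lambda$, $z\mapsto\eta$; $\nabla_z\bar\lambda,\nabla_z\bar\eta$ denote the same matrices evaluated at $\bar z$. Index sets at a feasible $z$ (subsets of $\{1,\dots,n_\lambda\}$): $\mathcal{I}_\lambda(z)=\{i\mid\lambda_i=0,\eta_i>0\}$, $\mathcal{I}_\eta(z)=\{i\mid\lambda_i>0,\eta_i=0\}$,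 $\mathcal{I}_{\lambda\eta}(z)=\{i\mid\lambda_i=0,\eta_i=0\}$. Weak stationarity: a feasible $z$ is weakly stationary if there exist $u\in\mathbb{R}^{n_h}$, $v,w\in\mathbb{R}^{n_\lambda}$ with $\nabla_zJ(z)+u^T\nabla_zh(z)-v^T\nabla_z\lambda-w^T\nabla_z\eta=0$, $w_i=0$ for $i\in\mathcal{I}_\lambda(z)$, $v_i=0$ for $i\in\mathcal{I}_\eta(z)$ (other components are free). It is strongly stationary if moreover $v_i\ge0$, $w_i\ge0$ for $i\in\mathcal{I}_{\lambda\eta}(z)$. MPCC-LICQ holds at a feasible $z$ if the vectors consisting of the rows of $\nabla_zh(z)$, the $\nabla_z\lambda_i$ with $i\in\mathcal{I}_\lambda(z)\cup\mathcal{I}_{\lambda\eta}(z)$, and the $\nabla_z\eta_i$ with $i\in\mathcal{I}_\eta(z)\cup\mathcal{I}_{\lambda\eta}(z)$ are linearly independent. ULSC (upper-level strict complementarity): a weakly stationary point $z$ satisfies the ULSC condition if there exist multipliers $u,v,w$ satisfying the weak stationarity conditions at $z$ with $v_iw_i\ne0$ for all $i\in\mathcal{I}_{\lambda\eta}(z)$. D-gap function: for fixed constants $b>a>0$, $\varphi^{ab}(\lambda,\eta)=\varphi^a(\lambda,\eta)-\varphi^b(\lambda,\eta)$, where for $c>0$, $\varphi^c(\lambda,\eta)=\frac1{2c}\big(\|\eta\|_2^2-\|\max(0,\eta-c\lambda)\|_2^2\big)$. It is $LC^1$. Write $\varphi^{ab}(z)=\varphi^{ab}(\lambda,\eta)$.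 Gap penalty reformulation: for $\mu>0$, $\mathcal{P}_{gap}(\mu)$ is the problem $\min_z J(z)+\mu\varphi^{ab}(z)$ s.t. $h(z)=0$. A point $z$ is a stationary point of $\mathcal{P}_{gap}(\mu)$ if $h(z)=0$ and there is $u\in\mathbb{R}^{n_h}$ with $\nabla_zJ(z)+\mu\nabla_z\varphi^{ab}(z)+u^T\nabla_zh(z)=0$. Second-order necessary condition of $\mathcal{P}_{gap}(\mu)$ at $z$: $D^2(J(z)+\mu\varphi^{ab}(z);d,d)\ge0$ for all $d\in\mathcal{C}(z)=\{d\in\mathbb{R}^{n_x+2n_\lambda}\mid\nabla_zh(z)d=0\}$, where for a real-valued $f$, $D(f(z);d)=\lim_{t\downarrow0}\frac{f(z+td)-f(z)}{t}$ and $D^2(f(z);d,p)=\lim_{t\downarrow0}\frac{f(z+td+t^2p)-f(z)-tD(f(z);d)}{t^2}$ (here applied to the function $f=J+\mu\varphi^{ab}$ with $p=d$). *)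

theory Defs
  imports "HOL-Analysis.Analysis"
begin

text \<open>
  The stacked variable \<open>z = [x; \<lambda>; \<eta>]\<close> is a vector whose coordinates are indexed by the disjoint
  sum of the three index types, so that its dimension is \<open>n\<^sub>x + 2 n\<^sub>\<lambda>\<close>.
\<close>

type_synonym ('x, 'l) zvec = "(real, 'x + 'l + 'l) vec"

definition lam_part :: "('x::finite, 'l::finite) zvec \<Rightarrow> real ^ 'l" where
  "lam_part z = (\<chi> i. z $ Inr (Inl i))"

definition eta_part :: "('x::finite, 'l::finite) zvec \<Rightarrow> real ^ 'l" where
  "eta_part z = (\<chi> i. z $ Inr (Inr i))"

definition LC2 :: "('a::real_normed_vector \<Rightarrow> 'b::real_normed_vector) \<Rightarrow> bool" where
  "LC2 f \<longleftrightarrow> (\<exists>(f' :: 'a \<Rightarrow> 'a \<Rightarrow>\<^sub>L 'b) (f'' :: 'a \<Rightarrow> 'a \<Rightarrow>\<^sub>L 'a \<Rightarrow>\<^sub>L 'b) L.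
     (\<forall>z. (f has_derivative blinfun_apply (f' z)) (at z)) \<and>
     (\<forall>z. (f' has_derivative blinfun_apply (f'' z)) (at z)) \<and>
     L-lipschitz_on UNIV f'')"

text \<open>The Jacobian of a scalar function, as a row vector; for vector-valued functions the library's
  \<^const>\<open>jacobian\<close> is used, and \<open>u v* A\<close> is the row vector \<open>u\<^sup>T A\<close>.\<close>

definition grad :: "(real ^ 'n \<Rightarrow> real) \<Rightarrow> real ^ 'n \<Rightarrow> real ^ 'n" where
  "grad f z = (\<chi> j. frechet_derivative f (at z) (axis j 1))"

definition mpcc_feasible ::
    "(('x::finite, 'l::finite) zvec \<Rightarrow> real ^ 'h) \<Rightarrow> ('x, 'l) zvec \<Rightarrow> bool" where
  "mpcc_feasible h z \<longleftrightarrow> h z = 0 \<and>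
     (\<forall>i. 0 \<le> lam_part z $ i) \<and> (\<forall>i. 0 \<le> eta_part z $ i) \<and> lam_part z \<bullet> eta_part z = 0"

definition I_lam :: "('x::finite, 'l::finite) zvec \<Rightarrow> 'l set" where
  "I_lam z = {i. lam_part z $ i = 0 \<and> eta_part z $ i > 0}"

definition I_eta :: "('x::finite, 'l::finite) zvec \<Rightarrow> 'l set" where
  "I_eta z = {i. lam_part z $ i > 0 \<and> eta_part z $ i = 0}"

definition I_lam_eta :: "('x::finite, 'l::finite) zvec \<Rightarrow> 'l set" where
  "I_lam_eta z = {i. lam_part z $ i = 0 \<and> eta_part z $ i = 0}"

definition weak_multipliers ::
    "(('x::finite, 'l::finite) zvec \<Rightarrow> real) \<Rightarrow> (('x, 'l) zvec \<Rightarrow> real ^ 'h) \<Rightarrow> ('x, 'l) zvec \<Rightarrow>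
     real ^ 'h \<Rightarrow> real ^ 'l \<Rightarrow> real ^ 'l \<Rightarrow> bool" where
  "weak_multipliers J h z u v w \<longleftrightarrow>
     grad J z + u v* jacobian h (at z) - v v* jacobian lam_part (at z)
       - w v* jacobian eta_part (at z) = 0 \<and>
     (\<forall>i \<in> I_lam z. w $ i = 0) \<and> (\<forall>i \<in> I_eta z. v $ i = 0)"

definition strongly_stationary ::
    "(('x::finite, 'l::finite) zvec \<Rightarrow> real) \<Rightarrow> (('x, 'l) zvec \<Rightarrow> real ^ 'h) \<Rightarrow> ('x, 'l) zvec \<Rightarrow> bool"
  where
  "strongly_stationary J h z \<longleftrightarrow> mpcc_feasible h z \<and>
     (\<exists>u v w. weak_multipliers J h z u v w \<and> (\<forall>i \<in> I_lam_eta z. v $ i \<ge> 0 \<and> w $ i \<ge> 0))"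

text \<open>
  The gradients active at \<open>z\<close> form an indexed family, so that a vector occurring twice makes it
  dependent; hence the injectivity requirement. Neither this condition nor \<open>ULSC\<close> below includes
  feasibility of \<open>z\<close>: where they are assumed of a limit point, its feasibility is left to be proved.
\<close>

definition active_row ::
    "(('x::finite, 'l::finite) zvec \<Rightarrow> real ^ 'h) \<Rightarrow> ('x, 'l) zvec \<Rightarrow> 'h + 'l + 'l \<Rightarrow> ('x, 'l) zvec" where
  "active_row h z = case_sum (\<lambda>j. row j (jacobian h (at z)))
     (case_sum (\<lambda>i. row i (jacobian lam_part (at z))) (\<lambda>i. row i (jacobian eta_part (at z))))"

definition MPCC_LICQ ::
    "(('x::finite, 'l::finite) zvec \<Rightarrow> real ^ 'h) \<Rightarrow> ('x, 'l) zvec \<Rightarrow> bool" where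
  "MPCC_LICQ h z \<longleftrightarrow>
     (let A = UNIV <+> ((I_lam z \<union> I_lam_eta z) <+> (I_eta z \<union> I_lam_eta z))
      in inj_on (active_row h z) A \<and> independent (active_row h z ` A))"

definition ULSC ::
    "(('x::finite, 'l::finite) zvec \<Rightarrow> real) \<Rightarrow> (('x, 'l) zvec \<Rightarrow> real ^ 'h) \<Rightarrow> ('x, 'l) zvec \<Rightarrow> bool"
  where
  "ULSC J h z \<longleftrightarrow>
     (\<exists>u v w. weak_multipliers J h z u v w \<and> (\<forall>i \<in> I_lam_eta z. v $ i * w $ i \<noteq> 0))"

definition phi :: "real \<Rightarrow> real ^ 'l \<Rightarrow> real ^ 'l \<Rightarrow> real" where
  "phi c lam eta =
     1 / (2 * c) * ((norm eta)\<^sup>2 - (norm (\<chi> i. max 0 ((eta - c *\<^sub>R lam) $ i)))\<^sup>2)"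

definition dgap :: "real \<Rightarrow> real \<Rightarrow> ('x::finite, 'l::finite) zvec \<Rightarrow> real" where
  "dgap a b z = phi a (lam_part z) (eta_part z) - phi b (lam_part z) (eta_part z)"

definition gap_stationary ::
    "real \<Rightarrow> real \<Rightarrow> (('x::finite, 'l::finite) zvec \<Rightarrow> real) \<Rightarrow> (('x, 'l) zvec \<Rightarrow> real ^ 'h) \<Rightarrow> real \<Rightarrow>
     ('x, 'l) zvec \<Rightarrow> bool" where
  "gap_stationary a b J h \<mu> z \<longleftrightarrow> h z = 0 \<and>
     (\<exists>u. grad J z + \<mu> *\<^sub>R grad (dgap a b) z + u v* jacobian h (at z) = 0)"

text \<open>
  Both limits below exist for \<open>f = J + \<mu> \<phi>\<^sup>a\<^sup>b\<close> with \<open>J\<close> twice continuously differentiable, since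
  \<open>\<phi>\<^sup>a\<^sup>b\<close> is continuously differentiable and piecewise quadratic; the unspecified value of
  \<^const>\<open>Lim\<close> at a divergent argument plays no role.
\<close>

definition dir_deriv :: "('a::real_normed_vector \<Rightarrow> real) \<Rightarrow> 'a \<Rightarrow> 'a \<Rightarrow> real" where
  "dir_deriv f z d = Lim (at_right 0) (\<lambda>t. (f (z + t *\<^sub>R d) - f z) / t)"

definition dir_deriv2 :: "('a::real_normed_vector \<Rightarrow> real) \<Rightarrow> 'a \<Rightarrow> 'a \<Rightarrow> 'a \<Rightarrow> real" where
  "dir_deriv2 f z d p =
     Lim (at_right 0) (\<lambda>t. (f (z + t *\<^sub>R d + t\<^sup>2 *\<^sub>R p) - f z - t * dir_deriv f z d) / t\<^sup>2)"

definition gap_second_order ::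
    "real \<Rightarrow> real \<Rightarrow> (('x::finite, 'l::finite) zvec \<Rightarrow> real) \<Rightarrow> (('x, 'l) zvec \<Rightarrow> real ^ 'h) \<Rightarrow> real \<Rightarrow>
     ('x, 'l) zvec \<Rightarrow> bool" where
  "gap_second_order a b J h \<mu> z \<longleftrightarrow>
     (\<forall>d. jacobian h (at z) *v d = 0 \<longrightarrow> dir_deriv2 (\<lambda>y. J y + \<mu> * dgap a b y) z d d \<ge> 0)"

end

theory Submission
  imports Defs
begin

text \<open>
  Since \<open>J + \<mu> \<phi>\<^sup>a\<^sup>b\<close> stays bounded while \<open>\<mu> \<rightarrow> \<infinity>\<close>, the nonnegative function \<open>\<phi>\<^sup>a\<^sup>b\<close> vanishes at the
  limit point, which is therefore feasible. By stationarity, \<open>-\<mu> \<nabla>\<phi>\<^sup>a\<^sup>b\<close> provides multipliers at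
  each iterate, and by MPCC-LICQ these converge to the unique weak multipliers \<open>v, w\<close> of the limit.
  For a biactive index \<open>i\<close>, upper-level strict complementarity makes both multipliers of index \<open>i\<close>
  eventually nonzero, which happens only if \<open>a \<lambda>\<^sub>i < \<eta>\<^sub>i < b \<lambda>\<^sub>i\<close> (both negative) or
  \<open>b \<lambda>\<^sub>i < \<eta>\<^sub>i < a \<lambda>\<^sub>i\<close> (both positive). In the former case \<open>\<phi>\<^sup>a\<^sup>b\<close> has curvature \<open>- a\<close> along
  \<open>\<lambda>\<^sub>i\<close>; MPCC-LICQ yields bounded feasible directions that see only this curvature, so for large
  \<open>\<mu>\<close> the second-order condition rules the case out.
\<close>

section \<open>Linear algebra: dual families and their convergence\<close>

lemma tendsto_det:
  fixes M :: "'k \<Rightarrow> real ^ 'n ^ 'n"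
  assumes "\<And>i j. ((\<lambda>k. M k $ i $ j) \<longlongrightarrow> M0 $ i $ j) F"
  shows "((\<lambda>k. det (M k)) \<longlongrightarrow> det M0) F"
  unfolding det_def by (intro tendsto_intros assms)

text \<open>Independence allows a linear functional with prescribed values on the family;
  \<open>adjoint f 1\<close> is the vector that represents it.\<close>

lemma dual_family_exists:
  fixes g :: "'n \<Rightarrow> 'e::euclidean_space"
  assumes inj: "inj_on g A" and ind: "independent (g ` A)"
  obtains D where "\<And>i j. i \<in> A \<Longrightarrow> j \<in> A \<Longrightarrow> g i \<bullet> D j = (if i = j then 1 else 0)"
proof -
  have "\<exists>d. \<forall>i\<in>A. g i \<bullet> d = (if i = j then 1 else 0)" if "j \<in> A" for j
  proof -
    obtain f :: "'e \<Rightarrow> real" where f: "linear f"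
      "\<forall>x\<in>g ` A. f x = (if x = g j then 1 else 0)"
      using linear_independent_extend[OF ind, of "\<lambda>x. if x = g j then 1 else (0::real)"] by blast
    have "g i \<bullet> adjoint f 1 = (if i = j then 1 else 0)" if "i \<in> A" for i
      using adjoint_works[OF f(1), of "g i" 1] f(2) that \<open>j \<in> A\<close> inj by (auto dest: inj_onD)
    then show ?thesis by blast
  qed
  then show ?thesis using that by metis
qed

text \<open>The dual vectors of the perturbed family are sought as combinations of the limiting ones
  \<open>D0\<close>. The coefficients solve a linear system whose matrix tends to the identity, and
  Cramer's rule writes them as quotients of determinants, hence as convergent quantities.\<close>

lemma tendsto_dual_family:
  fixes g :: "'k \<Rightarrow> 'n::finite \<Rightarrow> 'e::euclidean_space"
  assumes lim: "\<And>i. i \<in> A \<Longrightarrow> ((\<lambda>k. g k i) \<longlongrightarrow> g0 i) F"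
    and inj: "inj_on g0 A" and ind: "independent (g0 ` A)"
  obtains D D0 where
    "\<And>j. j \<in> A \<Longrightarrow> ((\<lambda>k. D k j) \<longlongrightarrow> D0 j) F"
    "\<forall>\<^sub>F k in F. \<forall>i\<in>A. \<forall>j\<in>A. g k i \<bullet> D k j = (if i = j then 1 else 0)"
    "\<And>i j. i \<in> A \<Longrightarrow> j \<in> A \<Longrightarrow> g0 i \<bullet> D0 j = (if i = j then 1 else 0)"
proof -
  obtain D0 where D0: "\<And>i j. i \<in> A \<Longrightarrow> j \<in> A \<Longrightarrow> g0 i \<bullet> D0 j = (if i = j then 1 else 0)"
    using dual_family_exists[OF inj ind] by blast
  \<comment> \<open>Filling up with the identity outside \<open>A\<close> gives a square matrix over
    the whole index type, so that \<open>det\<close> and \<open>cramer\<close> apply.\<close>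
  define M :: "'k \<Rightarrow> real ^ 'n ^ 'n" where
    "M k = (\<chi> i l. if i \<in> A \<and> l \<in> A then g k i \<bullet> D0 l else if i = l then 1 else 0)" for k
  \<comment> \<open>Cramer's numerator: column \<open>m\<close> is replaced by the right-hand side
    \<open>axis j 1\<close>.\<close>
  define N :: "real ^ 'n ^ 'n \<Rightarrow> 'n \<Rightarrow> 'n \<Rightarrow> real ^ 'n ^ 'n" where
    "N B j m = (\<chi> i l. if l = m then axis j 1 $ i else B $ i $ l)" for B j m
  define x :: "'k \<Rightarrow> 'n \<Rightarrow> real ^ 'n" where
    "x k j = (\<chi> m. det (N (M k) j m) / det (M k))" for k j
  have M: "((\<lambda>k. M k $ i $ l) \<longlongrightarrow> mat 1 $ i $ l) F" for i l
  proof (cases "i \<in> A \<and> l \<in> A")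
    case True
    then have "((\<lambda>k. g k i \<bullet> D0 l) \<longlongrightarrow> g0 i \<bullet> D0 l) F"
      by (intro tendsto_intros lim) auto
    then show ?thesis using True D0 by (simp add: M_def mat_def)
  qed (auto simp: M_def mat_def)
  have det: "((\<lambda>k. det (M k)) \<longlongrightarrow> 1) F"
    using tendsto_det[OF M] by simp
  have N: "((\<lambda>k. det (N (M k) j m)) \<longlongrightarrow> det (N (mat 1) j m)) F" for j m
    by (rule tendsto_det) (use M in \<open>auto simp: N_def\<close>)
  \<comment> \<open>For the identity matrix the solution is known, so Cramer's rule read backwards
    evaluates the limits of the numerators.\<close>
  have "(axis j 1 :: real ^ 'n) = (\<chi> m. det (N (mat 1) j m) / det (mat 1 :: real ^ 'n ^ 'n))" for j
    using cramer[of "mat 1 :: real ^ 'n ^ 'n" "axis j 1" "axis j 1"] by (simp add: N_def)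
  then have det_N: "det (N (mat 1) j m) = axis j 1 $ m" for j m
    by (metis (no_types, lifting) det_I div_by_1 vec_lambda_beta)
  have x: "((\<lambda>k. x k j $ m) \<longlongrightarrow> axis j 1 $ m) F" for j m
    using tendsto_divide[OF N[of j m] det] by (simp add: x_def det_N)
  show ?thesis
  proof (rule that)
    show "((\<lambda>k. \<Sum>l\<in>A. x k j $ l *\<^sub>R D0 l) \<longlongrightarrow> D0 j) F" if "j \<in> A" for j
    proof -
      have "((\<lambda>k. \<Sum>l\<in>A. x k j $ l *\<^sub>R D0 l) \<longlongrightarrow> (\<Sum>l\<in>A. axis j 1 $ l *\<^sub>R D0 l)) F"
        by (intro tendsto_intros x)
      also have "(\<Sum>l\<in>A. axis j 1 $ l *\<^sub>R D0 l) = (\<Sum>l\<in>A. if l = j then D0 l else 0)"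
        by (rule sum.cong) (auto simp: axis_def)
      also have "\<dots> = D0 j" using that by simp
      finally show ?thesis .
    qed
    have "\<forall>\<^sub>F k in F. det (M k) \<noteq> 0"
      using tendsto_imp_eventually_ne[OF det] by simp
    then show "\<forall>\<^sub>F k in F. \<forall>i\<in>A. \<forall>j\<in>A.
        g k i \<bullet> (\<Sum>l\<in>A. x k j $ l *\<^sub>R D0 l) = (if i = j then 1 else 0)"
    proof eventually_elim
      case (elim k)
      show ?case
      proof (intro ballI)
        fix i j assume ij: "i \<in> A" "j \<in> A"
        have "M k *v x k j = axis j 1"
          using cramer[OF elim, of "x k j" "axis j 1"] by (simp add: x_def N_def)
        then have "(\<Sum>l\<in>UNIV. M k $ i $ l * x k j $ l) = axis j 1 $ i"
          by (simp add: matrix_vector_mult_def vec_eq_iff)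
        \<comment> \<open>A row of \<open>M k\<close> indexed by \<open>A\<close> vanishes in the
          columns outside \<open>A\<close>, so the padding contributes nothing.\<close>
        moreover have "(\<Sum>l\<in>UNIV. M k $ i $ l * x k j $ l) = (\<Sum>l\<in>A. M k $ i $ l * x k j $ l)"
          using ij by (intro sum.mono_neutral_right) (auto simp: M_def)
        moreover have "\<dots> = (\<Sum>l\<in>A. (g k i \<bullet> D0 l) * x k j $ l)"
          using ij by (intro sum.cong) (auto simp: M_def)
        ultimately show "g k i \<bullet> (\<Sum>l\<in>A. x k j $ l *\<^sub>R D0 l) = (if i = j then 1 else 0)"
          by (simp add: inner_sum_right axis_def mult.commute)
      qed
    qed
  qed (use D0 in auto)
qed

section \<open>The D-gap function of a single complementarity pair\<close>

definition dgap1 :: "real \<Rightarrow> real \<Rightarrow> real \<Rightarrow> real \<Rightarrow> real" where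
  "dgap1 a b l e = (e\<^sup>2 - (max 0 (e - a * l))\<^sup>2) / (2 * a) - (e\<^sup>2 - (max 0 (e - b * l))\<^sup>2) / (2 * b)"

text \<open>The partial derivative of \<open>dgap1\<close> in \<open>l\<close>; the next definition
  is the one in \<open>e\<close>. Multiplied by the penalty parameter they approximate
  \<open>- v $ i\<close> and \<open>- w $ i\<close>.\<close>

definition dgap_l :: "real \<Rightarrow> real \<Rightarrow> real \<Rightarrow> real \<Rightarrow> real" where
  "dgap_l a b l e = max 0 (e - a * l) - max 0 (e - b * l)"

definition dgap_e :: "real \<Rightarrow> real \<Rightarrow> real \<Rightarrow> real \<Rightarrow> real" where
  "dgap_e a b l e = (e - max 0 (e - a * l)) / a - (e - max 0 (e - b * l)) / b"

text \<open>The signs of \<open>e - a * l\<close> and \<open>e - b * l\<close> cut the plane into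
  four regions, and \<open>dgap1\<close> is one quadratic polynomial on each. Here, and in the
  opposite region below, it depends on a single variable, so one partial derivative
  vanishes.\<close>

lemma dgap1_eq_left:
  assumes "0 < a" "a < b" "a * l < e" "b * l < e"
  shows "dgap1 a b l e = (b - a) / 2 * l\<^sup>2" "dgap_e a b l e = 0"
  using assms by (auto simp: dgap1_def dgap_e_def field_simps power2_eq_square)

lemma dgap1_eq_right:
  assumes "0 < a" "a < b" "e \<le> a * l" "e \<le> b * l"
  shows "dgap1 a b l e = (1 / a - 1 / b) / 2 * e\<^sup>2" "dgap_l a b l e = 0"
  using assms by (auto simp: dgap1_def dgap_l_def max_def field_simps)

text \<open>In this region \<open>l\<close> is positive, and the second derivative in
  \<open>l\<close> is \<open>- a\<close>: the source of the negative curvature.\<close>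

lemma dgap1_eq_pos:
  assumes "0 < a" "a < b" "a * l < e" "e \<le> b * l"
  shows "dgap1 a b l e = e * l - a / 2 * l\<^sup>2 - e\<^sup>2 / (2 * b)" "dgap_l a b l e = e - a * l"
  using assms by (auto simp: dgap1_def dgap_l_def max_def field_simps power2_eq_square)

text \<open>In this region \<open>l\<close> is negative and neither partial derivative is positive,
  which finally gives the signs of the multipliers.\<close>

lemma dgap1_eq_neg:
  assumes "0 < a" "a < b" "b * l < e" "e \<le> a * l"
  shows "dgap1 a b l e = e\<^sup>2 / (2 * a) - e * l + b / 2 * l\<^sup>2"
    "dgap_l a b l e = b * l - e" "dgap_e a b l e = e / a - l"
  using assms by (auto simp: dgap1_def dgap_l_def dgap_e_def max_def field_simps power2_eq_square)

text \<open>In the first two regions the value is a positive multiple of the square of one variable,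
  and its zeros are complementary pairs. In the third, \<open>e * l\<close> is split into halves
  that dominate the two negative terms, one of them strictly; in the fourth, completing the square
  leaves a positive multiple of \<open>l\<^sup>2\<close>. So there are no zeros in the last
  two.\<close>

lemma dgap1_nonneg_and_zeros:
  assumes ab: "0 < a" "a < b"
  shows "0 \<le> dgap1 a b l e \<and> (dgap1 a b l e = 0 \<longrightarrow> 0 \<le> l \<and> 0 \<le> e \<and> l * e = 0)"
proof -
  consider "a * l < e" "b * l < e" | "e \<le> a * l" "e \<le> b * l" | "a * l < e" "e \<le> b * l"
    | "b * l < e" "e \<le> a * l" by linarith
  then show ?thesis
  proof cases
    case 1
    have "0 \<le> l \<and> 0 \<le> e \<and> l * e = 0" if "l = 0" using that 1 by simp
    then show ?thesis unfolding dgap1_eq_left(1)[OF ab 1] using ab by auto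
  next
    case 2
    have "1 / a - 1 / b > 0" using ab by (simp add: frac_less2)
    moreover have "0 \<le> l" if "e = 0" using that 2 ab by (simp add: zero_le_mult_iff)
    ultimately show ?thesis unfolding dgap1_eq_right(1)[OF ab 2] by auto
  next
    case 3
    have "a * l < b * l" using 3 by linarith
    then have l: "0 < l" using ab by (auto simp: mult_less_cancel_right)
    have e: "0 < e" using 3 mult_pos_pos[OF ab(1) l] by linarith
    have "e\<^sup>2 / (2 * b) \<le> e * l / 2"
      using 3 ab e by (simp add: field_simps power2_eq_square)
    moreover have "a / 2 * l\<^sup>2 < e * l / 2"
      using mult_strict_right_mono[OF 3(1) l] by (simp add: power2_eq_square)
    ultimately have "dgap1 a b l e > 0" using dgap1_eq_pos[OF ab 3] by linarith
    then show ?thesis by simp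
  next
    case 4
    have "b * l < a * l" using 4 by linarith
    then have l: "l < 0" using ab by (auto simp: mult_less_cancel_right)
    have "dgap1 a b l e = (e - a * l)\<^sup>2 / (2 * a) + (b - a) / 2 * l\<^sup>2"
      using ab by (simp add: dgap1_eq_neg[OF ab 4] field_simps power2_eq_square)
    moreover have "(b - a) / 2 * l\<^sup>2 > 0" using ab l by simp
    moreover have "(e - a * l)\<^sup>2 / (2 * a) \<ge> 0" using ab by simp
    ultimately show ?thesis by linarith
  qed
qed

section \<open>The D-gap function as a sum over pairs: sign, zeros, differentiability\<close>

lemma dgap_eq_sum:
  assumes "0 < a" "a < b"
  shows "dgap a b y = (\<Sum>i\<in>UNIV. dgap1 a b (lam_part y $ i) (eta_part y $ i))"
proof -
  have nrm: "(norm v)\<^sup>2 = (\<Sum>i\<in>UNIV. (v $ i)\<^sup>2)" for v :: "real ^ 'b"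
    by (simp add: norm_vec_def L2_set_def sum_nonneg)
  show ?thesis
    by (simp add: dgap_def phi_def nrm dgap1_def sum_subtractf flip: sum_divide_distrib)
qed

lemma dgap_nonneg:
  assumes "0 < a" "a < b" shows "0 \<le> dgap a b y"
  using dgap1_nonneg_and_zeros[OF assms] by (simp add: dgap_eq_sum[OF assms] sum_nonneg)

lemma dgap_eq_0D:
  assumes ab: "0 < a" "a < b" and "dgap a b y = 0"
  shows "0 \<le> lam_part y $ i" "0 \<le> eta_part y $ i" "lam_part y $ i * eta_part y $ i = 0"
proof -
  have "dgap1 a b (lam_part y $ i) (eta_part y $ i) = 0"
    using assms(3) dgap1_nonneg_and_zeros[OF ab] by (simp add: dgap_eq_sum[OF ab] sum_nonneg_eq_0_iff)
  with dgap1_nonneg_and_zeros[OF ab] show "0 \<le> lam_part y $ i" "0 \<le> eta_part y $ i"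
    "lam_part y $ i * eta_part y $ i = 0" by blast+
qed

text \<open>Squaring removes the kink: at 0 the difference quotient is \<open>max 0 h\<close>, which
  tends to 0. Elsewhere the function agrees locally with 0 or with the square.\<close>

lemma has_real_derivative_pos_part_square:
  "((\<lambda>x. (max 0 x)\<^sup>2) has_real_derivative 2 * max 0 x) (at (x::real))"
proof -
  consider "x < 0" | "x = 0" | "x > 0" by linarith
  then show ?thesis
  proof cases
    case 1
    have "((\<lambda>x. 0) has_real_derivative 0) (at x)" by simp
    then have "((\<lambda>x. (max 0 x)\<^sup>2) has_real_derivative 0) (at x)"
      by (rule DERIV_cong_ev[THEN iffD1, rotated -1])
        (use eventually_nhds_in_open[of "{..<0}" x] 1 in \<open>auto elim!: eventually_mono\<close>)
    then show ?thesis using 1 by simp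
  next
    case 3
    have "((\<lambda>x. x\<^sup>2) has_real_derivative 2 * x) (at x)" by (auto intro!: derivative_eq_intros)
    then have "((\<lambda>x. (max 0 x)\<^sup>2) has_real_derivative 2 * x) (at x)"
      by (rule DERIV_cong_ev[THEN iffD1, rotated -1])
        (use eventually_nhds_in_open[of "{0<..}" x] 3 in \<open>auto elim!: eventually_mono\<close>)
    then show ?thesis using 3 by simp
  next
    case 2
    have "((\<lambda>h. max 0 h) \<longlongrightarrow> 0) (at (0::real))"
      by (auto intro!: tendsto_eq_intros)
    moreover have "\<forall>\<^sub>F h in at 0. max 0 h = (max 0 h)\<^sup>2 / (h::real)"
      by (auto simp: eventually_at_filter max_def power2_eq_square)
    ultimately have "((\<lambda>h. (max 0 h)\<^sup>2 / h) \<longlongrightarrow> 0) (at (0::real))"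
      by (rule Lim_transform_eventually)
    then show ?thesis using 2 by (simp add: DERIV_def)
  qed
qed

lemma has_derivative_dgap1:
  assumes "0 < a" "a < b" "(l has_derivative l') (at y)" "(e has_derivative e') (at y)"
  shows "((\<lambda>y. dgap1 a b (l y) (e y)) has_derivative
    (\<lambda>d. dgap_l a b (l y) (e y) * l' d + dgap_e a b (l y) (e y) * e' d)) (at y)"
proof -
  have sq: "((\<lambda>y. (max 0 (e y - c * l y))\<^sup>2) has_derivative
      (\<lambda>d. 2 * max 0 (e y - c * l y) * (e' d - c * l' d))) (at y)" for c
    by (rule has_derivative_compose[OF _ has_real_derivative_pos_part_square
          [unfolded has_field_derivative_def], where f = "\<lambda>y. e y - c * l y"])
      (auto intro!: derivative_eq_intros assms)
  have quot: "((\<lambda>y. ((e y)\<^sup>2 - (max 0 (e y - c * l y))\<^sup>2) / (2 * c)) has_derivative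
      (\<lambda>d. (2 * e y * e' d - 2 * max 0 (e y - c * l y) * (e' d - c * l' d)) / (2 * c))) (at y)" for c
    by (rule bounded_linear.has_derivative[OF bounded_linear_divide])
      (rule has_derivative_diff[OF _ sq], auto intro!: derivative_eq_intros assms)
  show ?thesis
    unfolding dgap1_def dgap_l_def dgap_e_def
    by (rule has_derivative_eq_rhs[OF has_derivative_diff[OF quot quot]])
      (use assms(1,2) in \<open>auto simp: fun_eq_iff field_simps\<close>)
qed

section \<open>Gradients, Jacobian rows and multiplier equations\<close>

lemma vector_matrix_mult_eq_sum_rows:
  fixes u :: "real ^ 'n"
  shows "u v* M = (\<Sum>i\<in>UNIV. u $ i *\<^sub>R row i M)"
  by (simp add: vec_eq_iff vector_matrix_mult_def row_def mult.commute)

lemma jacobian_lam_part: "row i (jacobian lam_part (at z)) = axis (Inr (Inl i)) 1"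
proof -
  have "bounded_linear lam_part"
    by (rule linear_conv_bounded_linear[THEN iffD1], rule linearI) (auto simp: lam_part_def vec_eq_iff)
  then have "frechet_derivative lam_part (at z) = lam_part"
    by (metis bounded_linear_imp_has_derivative frechet_derivative_at)
  then show ?thesis
    by (auto simp: jacobian_def row_def matrix_def lam_part_def axis_def vec_eq_iff)
qed

lemma jacobian_eta_part: "row i (jacobian eta_part (at z)) = axis (Inr (Inr i)) 1"
proof -
  have "bounded_linear eta_part"
    by (rule linear_conv_bounded_linear[THEN iffD1], rule linearI) (auto simp: eta_part_def vec_eq_iff)
  then have "frechet_derivative eta_part (at z) = eta_part"
    by (metis bounded_linear_imp_has_derivative frechet_derivative_at)
  then show ?thesis
    by (auto simp: jacobian_def row_def matrix_def eta_part_def axis_def vec_eq_iff)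
qed

lemma active_row_simps [simp]:
  "active_row h z (Inl j) = row j (jacobian h (at z))"
  "active_row h z (Inr (Inl i)) = axis (Inr (Inl i)) 1"
  "active_row h z (Inr (Inr i)) = axis (Inr (Inr i)) 1"
  by (simp_all add: active_row_def jacobian_lam_part jacobian_eta_part)

lemma sum_UNIV_Plus:
  fixes f :: "'a::finite + 'b::finite \<Rightarrow> 'c::comm_monoid_add"
  shows "sum f UNIV = (\<Sum>x\<in>UNIV. f (Inl x)) + (\<Sum>x\<in>UNIV. f (Inr x))"
  by (simp add: sum.Plus o_def flip: UNIV_Plus_UNIV)

lemma grad_inner:
  assumes "(f has_derivative f') (at z)"
  shows "grad f z \<bullet> d = f' d"
proof -
  have lin: "linear f'" using assms by (simp add: has_derivative_linear)
  have "f' d = f' (\<Sum>j\<in>UNIV. d $ j *\<^sub>R axis j 1)"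
    by (simp add: basis_expansion flip: scalar_mult_eq_scaleR)
  also have "\<dots> = (\<Sum>j\<in>UNIV. d $ j * f' (axis j 1))"
    by (simp add: linear_sum[OF lin] linear_cmul[OF lin])
  also have "\<dots> = grad f z \<bullet> d"
    using frechet_derivative_at[OF assms] by (simp add: grad_def inner_vec_def mult.commute)
  finally show ?thesis by simp
qed

lemma tendsto_grad:
  assumes der: "\<And>x. (f has_derivative blinfun_apply (f' x)) (at x)" and lim: "((\<lambda>k. f' (x k)) \<longlongrightarrow> f' x0) F"
  shows "((\<lambda>k. grad f (x k)) \<longlongrightarrow> grad f x0) F"
proof (rule vec_tendstoI)
  have "grad f y $ j = f' y (axis j 1)" for y j
    using frechet_derivative_at[OF der, of y] by (simp add: grad_def)
  then show "((\<lambda>k. grad f (x k) $ j) \<longlongrightarrow> grad f x0 $ j) F" for j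
    using lim by (simp, intro tendsto_intros)
qed

lemma tendsto_row_jacobian:
  fixes f :: "real ^ 'n \<Rightarrow> real ^ 'm"
  assumes der: "\<And>x. (f has_derivative blinfun_apply (f' x)) (at x)" and lim: "((\<lambda>k. f' (x k)) \<longlongrightarrow> f' x0) F"
  shows "((\<lambda>k. row i (jacobian f (at (x k)))) \<longlongrightarrow> row i (jacobian f (at x0))) F"
proof (rule vec_tendstoI)
  have "row i (jacobian f (at y)) $ j = f' y (axis j 1) $ i" for y j
    using frechet_derivative_at[OF der, of y] by (simp add: jacobian_def matrix_def row_def)
  then show "((\<lambda>k. row i (jacobian f (at (x k))) $ j) \<longlongrightarrow> row i (jacobian f (at x0)) $ j) F" for j
    using lim by (simp, intro tendsto_intros)
qed

lemma has_derivative_dgap: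
  fixes z :: "('x::finite, 'l::finite) zvec"
  assumes "0 < a" "a < b"
  shows "(dgap a b has_derivative (\<lambda>d. \<Sum>i\<in>UNIV.
      dgap_l a b (lam_part z $ i) (eta_part z $ i) * lam_part d $ i +
      dgap_e a b (lam_part z $ i) (eta_part z $ i) * eta_part d $ i)) (at z)"
proof -
  have "((\<lambda>y. lam_part y $ i) has_derivative (\<lambda>d. lam_part d $ i)) (at z)"
    "((\<lambda>y. eta_part y $ i) has_derivative (\<lambda>d. eta_part d $ i)) (at z)" for i
    by (auto simp: lam_part_def eta_part_def
        intro!: bounded_linear_imp_has_derivative bounded_linear_vec_nth)
  then show ?thesis
    using assms by (subst ext[OF dgap_eq_sum[OF assms]])
      (intro has_derivative_sum has_derivative_dgap1)
qed

text \<open>The gradients of \<lambda> and \<eta> are unit vectors, so the gradient of the penalty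
  is itself a combination of active rows. This gives stationarity of the penalty problem the same
  shape as weak stationarity below, ready to be paired with a dual family.\<close>

lemma gap_stationary_multipliers:
  assumes "0 < a" "a < b" "gap_stationary a b J h \<mu> z"
  shows "\<exists>u. (\<Sum>s\<in>UNIV. case_sum (($) u)
      (case_sum (\<lambda>i. \<mu> * dgap_l a b (lam_part z $ i) (eta_part z $ i))
        (\<lambda>i. \<mu> * dgap_e a b (lam_part z $ i) (eta_part z $ i))) s *\<^sub>R active_row h z s) = - grad J z"
proof -
  obtain u where u: "grad J z + \<mu> *\<^sub>R grad (dgap a b) z + u v* jacobian h (at z) = 0"
    using assms(3) by (auto simp: gap_stationary_def)
  have "grad (dgap a b) z = (\<Sum>i\<in>UNIV. dgap_l a b (lam_part z $ i) (eta_part z $ i) *\<^sub>R axis (Inr (Inl i)) 1)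
      + (\<Sum>i\<in>UNIV. dgap_e a b (lam_part z $ i) (eta_part z $ i) *\<^sub>R axis (Inr (Inr i)) 1)"
    (is "_ = ?g")
  proof (rule vector_eq_ldot[THEN iffD1], rule allI)
    show "d \<bullet> grad (dgap a b) z = d \<bullet> ?g" for d
      using grad_inner[OF has_derivative_dgap[OF assms(1,2)], of z d]
      by (simp add: inner_commute[of d] inner_add_left inner_sum_left inner_axis' sum.distrib
          lam_part_def eta_part_def)
  qed
  then have "(\<Sum>s\<in>UNIV. case_sum (($) u)
      (case_sum (\<lambda>i. \<mu> * dgap_l a b (lam_part z $ i) (eta_part z $ i))
        (\<lambda>i. \<mu> * dgap_e a b (lam_part z $ i) (eta_part z $ i))) s *\<^sub>R active_row h z s)
      = \<mu> *\<^sub>R grad (dgap a b) z + u v* jacobian h (at z)"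
    by (simp add: sum_UNIV_Plus vector_matrix_mult_eq_sum_rows scaleR_sum_right scaleR_add_right)
  also have "\<dots> = - grad J z" using u by (simp add: algebra_simps eq_neg_iff_add_eq_0)
  finally show ?thesis ..
qed

lemma weak_multipliersD:
  assumes "weak_multipliers J h z u v w"
  shows "(\<Sum>s\<in>UNIV. case_sum (($) u) (case_sum (\<lambda>i. - v $ i) (\<lambda>i. - w $ i)) s *\<^sub>R active_row h z s)
    = - grad J z"
  using assms
  by (simp add: weak_multipliers_def sum_UNIV_Plus vector_matrix_mult_eq_sum_rows jacobian_lam_part
      jacobian_eta_part sum_negf eq_neg_iff_add_eq_0 algebra_simps)

text \<open>Pairing with \<open>D j\<close> isolates one term: the other coefficients in
  \<open>A\<close> are removed by duality, those outside \<open>A\<close> are zero. Multipliers thus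
  become inner products, whose limits can be taken.\<close>

lemma coefficient_eq_inner_dual:
  assumes "(\<Sum>s\<in>UNIV. y s *\<^sub>R g s) = c" "\<And>s. s \<notin> A \<Longrightarrow> y s = 0"
    and "\<forall>i\<in>A. \<forall>j\<in>A. g i \<bullet> D j = (if i = j then 1 else (0::real))" "j \<in> (A :: 'n::finite set)"
  shows "y j = c \<bullet> D j"
proof -
  have "c \<bullet> D j = (\<Sum>s\<in>UNIV. y s * (g s \<bullet> D j))"
    by (simp add: assms(1)[symmetric] inner_sum_left)
  also have "\<dots> = (\<Sum>s\<in>UNIV. if s = j then y j else 0)"
    using assms(2-4) by (intro sum.cong refl) (metis mult_zero_left mult.right_neutral mult_zero_right)
  finally show ?thesis by simp
qed

section \<open>Second-order directional derivatives and curvature\<close>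

text \<open>Taylor's formula with Lagrange remainder along the line; the intermediate parameter is
  squeezed between 0 and \<open>t\<close>, and continuity of the second derivative does the
  rest.\<close>

lemma second_difference_quotient:
  fixes f :: "'a::real_normed_vector \<Rightarrow> real"
    and f' :: "'a \<Rightarrow> 'a \<Rightarrow>\<^sub>L real" and f'' :: "'a \<Rightarrow> 'a \<Rightarrow>\<^sub>L 'a \<Rightarrow>\<^sub>L real"
  assumes f': "\<And>z. (f has_derivative blinfun_apply (f' z)) (at z)"
    and f'': "\<And>z. (f' has_derivative blinfun_apply (f'' z)) (at z)"
    and cont: "continuous_on UNIV f''"
  shows "((\<lambda>t. (f (z + t *\<^sub>R d) - f z - t * f' z d) / t\<^sup>2) \<longlongrightarrow> f'' z d d / 2) (at_right 0)"
proof -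
  have lin: "((\<lambda>t. z + t *\<^sub>R d) has_derivative (\<lambda>t. t *\<^sub>R d)) (at t)" for t
    by (auto intro!: derivative_eq_intros)
  have 1: "((\<lambda>t. f (z + t *\<^sub>R d)) has_real_derivative f' (z + t *\<^sub>R d) d) (at t)" for t
    using has_derivative_compose[OF lin f']
    by (simp add: has_field_derivative_def blinfun.scaleR_right mult_commute_abs)
  have 2: "((\<lambda>t. f' (z + t *\<^sub>R d) d) has_real_derivative f'' (z + t *\<^sub>R d) d d) (at t)" for t
    using bounded_linear.has_derivative[OF blinfun.bounded_linear_left has_derivative_compose[OF lin f'']]
    by (simp add: has_field_derivative_def blinfun.scaleR_right blinfun.scaleR_left mult_commute_abs)
  \<comment> \<open>The sequence of derivatives that \<open>Maclaurin\<close> expects; with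
    expansion order 2 only the entries 0, 1 and 2 matter.\<close>
  define \<phi> where "\<phi> m t = (if m = 0 then f (z + t *\<^sub>R d) else if m = 1 then f' (z + t *\<^sub>R d) d
      else f'' (z + t *\<^sub>R d) d d)" for m :: nat and t
  have "\<exists>\<xi>. 0 < \<xi> \<and> \<xi> < t \<and>
      (f (z + t *\<^sub>R d) - f z - t * f' z d) / t\<^sup>2 = f'' (z + \<xi> *\<^sub>R d) d d / 2" if "0 < t" for t
  proof -
    have "\<exists>\<xi>. 0 < \<xi> \<and> \<xi> < t \<and>
        \<phi> 0 t = (\<Sum>m<2. \<phi> m 0 / fact m * t ^ m) + \<phi> 2 \<xi> / fact 2 * t ^ 2"
      by (rule Maclaurin[OF that]) (auto simp: \<phi>_def less_2_cases_iff 1 2)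
    then show ?thesis using that by (auto simp: \<phi>_def numeral_2_eq_2 field_simps)
  qed
  then obtain \<xi> where \<xi>: "\<And>t. 0 < t \<Longrightarrow> 0 < \<xi> t \<and> \<xi> t < t \<and>
      (f (z + t *\<^sub>R d) - f z - t * f' z d) / t\<^sup>2 = f'' (z + \<xi> t *\<^sub>R d) d d / 2"
    by metis
  have "(\<xi> \<longlongrightarrow> 0) (at_right 0)"
  proof (rule tendsto_sandwich)
    show "\<forall>\<^sub>F t in at_right 0. 0 \<le> \<xi> t" "\<forall>\<^sub>F t in at_right 0. \<xi> t \<le> t"
      using eventually_at_right_less[of "0::real"] by (eventually_elim; use \<xi> in force)+
  qed (auto intro: tendsto_ident_at)
  then have "((\<lambda>t. z + \<xi> t *\<^sub>R d) \<longlongrightarrow> z + 0 *\<^sub>R d) (at_right 0)"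
    by (intro tendsto_intros)
  then have "((\<lambda>t. f'' (z + \<xi> t *\<^sub>R d)) \<longlongrightarrow> f'' z) (at_right 0)"
    using continuous_on_tendsto_compose[OF cont, of "\<lambda>t. z + \<xi> t *\<^sub>R d" z] by simp
  then have "((\<lambda>t. f'' (z + \<xi> t *\<^sub>R d) d d / 2) \<longlongrightarrow> f'' z d d / 2) (at_right 0)"
    by (intro tendsto_intros) auto
  then show ?thesis
    by (rule Lim_transform_eventually)
      (use eventually_at_right_less[of "0::real"] in \<open>eventually_elim, simp add: \<xi>\<close>)
qed

lemma dir_deriv_eq:
  assumes "(f has_derivative f') (at z)"
  shows "dir_deriv f z d = f' d"
proof -
  interpret f': bounded_linear f' using assms by (rule has_derivative_bounded_linear)
  have "((\<lambda>t. z + t *\<^sub>R d) has_derivative (\<lambda>t. t *\<^sub>R d)) (at (0::real))"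
    by (auto intro!: derivative_eq_intros)
  then have "((\<lambda>t. f (z + t *\<^sub>R d)) has_derivative (\<lambda>t. f' (t *\<^sub>R d))) (at 0)"
    by (rule has_derivative_compose) (use assms in simp)
  then have "((\<lambda>t. f (z + t *\<^sub>R d)) has_real_derivative f' d) (at 0)"
    by (simp add: has_field_derivative_def f'.scaleR mult_commute_abs)
  then have "((\<lambda>t. (f (z + t *\<^sub>R d) - f z) / t) \<longlongrightarrow> f' d) (at 0)"
    by (simp add: DERIV_def)
  then have "((\<lambda>t. (f (z + t *\<^sub>R d) - f z) / t) \<longlongrightarrow> f' d) (at_right 0)"
    by (rule filterlim_mono) (auto simp: at_le)
  then show ?thesis unfolding dir_deriv_def by (rule tendsto_Lim[rotated]) simp
qed

text \<open>For equal directions the parabolic arc runs along the line with parameter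
  \<open>t + t\<^sup>2\<close>, and the first-order term is zero. Since
  \<open>(t + t\<^sup>2)\<^sup>2 / t\<^sup>2 = (1 + t)\<^sup>2\<close> tends to 1, the arc and the
  line give the same limit.\<close>

lemma dir_deriv2_stationary:
  assumes f: "(f has_derivative f') (at z)" "f' d = 0"
    and lim: "((\<lambda>s. (f (z + s *\<^sub>R d) - f z) / s\<^sup>2) \<longlongrightarrow> c) (at_right 0)"
  shows "dir_deriv2 f z d d = c"
proof -
  have "((\<lambda>t::real. t + t\<^sup>2) \<longlongrightarrow> 0) (at_right 0)"
    by (auto intro!: tendsto_eq_intros)
  moreover have "\<forall>\<^sub>F t in at_right 0. t + t\<^sup>2 \<in> {0<..} \<and> t + t\<^sup>2 \<noteq> (0::real)"
    using eventually_at_right_less[of "0::real"]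
  proof eventually_elim
    case (elim t)
    then have "0 < t + t\<^sup>2" by (intro add_pos_pos) simp_all
    then show ?case by simp
  qed
  ultimately have "filterlim (\<lambda>t::real. t + t\<^sup>2) (at_right 0) (at_right 0)"
    by (simp add: filterlim_at)
  with lim have "((\<lambda>t. (f (z + (t + t\<^sup>2) *\<^sub>R d) - f z) / (t + t\<^sup>2)\<^sup>2) \<longlongrightarrow> c) (at_right 0)"
    by (rule filterlim_compose)
  moreover have "((\<lambda>t::real. (1 + t)\<^sup>2) \<longlongrightarrow> 1) (at_right 0)"
    by (auto intro!: tendsto_eq_intros)
  ultimately have "((\<lambda>t. (f (z + (t + t\<^sup>2) *\<^sub>R d) - f z) / (t + t\<^sup>2)\<^sup>2 * (1 + t)\<^sup>2) \<longlongrightarrow> c * 1) (at_right 0)"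
    by (rule tendsto_mult)
  moreover have "\<forall>\<^sub>F t in at_right 0. (f (z + (t + t\<^sup>2) *\<^sub>R d) - f z) / (t + t\<^sup>2)\<^sup>2 * (1 + t)\<^sup>2
      = (f (z + t *\<^sub>R d + t\<^sup>2 *\<^sub>R d) - f z - t * dir_deriv f z d) / t\<^sup>2"
  proof -
    have "x / (t + t\<^sup>2)\<^sup>2 * (1 + t)\<^sup>2 = x / t\<^sup>2" if "0 < t" for x t :: real
    proof -
      have "t + t\<^sup>2 = t * (1 + t)" by (simp add: power2_eq_square algebra_simps)
      with that show ?thesis by (simp add: power_mult_distrib)
    qed
    then show ?thesis
      using eventually_at_right_less[of "0::real"]
      by (auto simp: dir_deriv_eq[OF f(1)] f(2) scaleR_left_distrib add.assoc elim: eventually_mono)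
  qed
  ultimately have "((\<lambda>t. (f (z + t *\<^sub>R d + t\<^sup>2 *\<^sub>R d) - f z - t * dir_deriv f z d) / t\<^sup>2) \<longlongrightarrow> c * 1) (at_right 0)"
    by (rule Lim_transform_eventually)
  then show ?thesis unfolding dir_deriv2_def by (intro tendsto_Lim) simp_all
qed

text \<open>The pair either stands still or moves only in the variable on which the local quadratic
  does not depend; strict inequalities keep it in its region for small \<open>s\<close>.\<close>

lemma dgap1_locally_const:
  assumes ab: "0 < a" "a < b"
    and "dl = 0 \<and> de = 0 \<or> a * l < e \<and> b * l < e \<and> dl = 0 \<or> e < a * l \<and> e < b * l \<and> de = 0"
  shows "\<forall>\<^sub>F s in at_right 0. dgap1 a b (l + s * dl) (e + s * de) = dgap1 a b l e"
    and "dgap_l a b l e * dl + dgap_e a b l e * de = 0"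
proof -
  have lim: "((\<lambda>s. c * (l + s * dl) - (e + s * de)) \<longlongrightarrow> c * (l + 0 * dl) - (e + 0 * de)) (at_right 0)" for c
    by (intro tendsto_intros)
  show "\<forall>\<^sub>F s in at_right 0. dgap1 a b (l + s * dl) (e + s * de) = dgap1 a b l e"
    using assms(3)
  proof (elim disjE conjE)
    assume *: "a * l < e" "b * l < e" "dl = 0"
    then have "\<forall>\<^sub>F s in at_right 0. a * (l + s * dl) - (e + s * de) < 0"
      "\<forall>\<^sub>F s in at_right 0. b * (l + s * dl) - (e + s * de) < 0"
      by (intro order_tendstoD(2)[OF lim]; simp)+
    then show ?thesis
      by eventually_elim (use * ab in \<open>simp add: dgap1_eq_left\<close>)
  next
    assume *: "e < a * l" "e < b * l" "de = 0"
    then have "\<forall>\<^sub>F s in at_right 0. a * (l + s * dl) - (e + s * de) > 0"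
      "\<forall>\<^sub>F s in at_right 0. b * (l + s * dl) - (e + s * de) > 0"
      by (intro order_tendstoD(1)[OF lim]; simp)+
    then show ?thesis
      by eventually_elim (use * ab in \<open>simp add: dgap1_eq_right\<close>)
  qed simp
  show "dgap_l a b l e * dl + dgap_e a b l e * de = 0"
    using assms(3) dgap1_eq_left(2)[OF ab, of l e] dgap1_eq_right(2)[OF ab, of e l] by auto
qed

text \<open>Along \<open>d\<close> the penalty changes only through the pair \<open>i\<close>, which
  contributes curvature \<open>- a\<close>, while stationarity cancels all first-order terms. The
  second-order quotient then tends to \<open>J'' z d d / 2 - \<mu> * a / 2\<close>, and the
  second-order condition makes this nonnegative.\<close>

lemma second_order_curvature_bound:
  fixes J :: "('x::finite, 'l::finite) zvec \<Rightarrow> real" and h :: "('x, 'l) zvec \<Rightarrow> real ^ 'h"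
  assumes J': "\<And>z. (J has_derivative blinfun_apply (J' z)) (at z)"
    and J'': "\<And>z. (J' has_derivative blinfun_apply (J'' z)) (at z)"
    and cont: "continuous_on UNIV J''"
    and ab: "0 < a" "a < b"
    and stat: "gap_stationary a b J h \<mu> z" and so: "gap_second_order a b J h \<mu> z"
    and hd: "jacobian h (at z) *v d = 0"
    and i: "a * lam_part z $ i < eta_part z $ i" "eta_part z $ i < b * lam_part z $ i"
      "lam_part d $ i = 1" "eta_part d $ i = 0"
    and others: "\<And>j. j \<noteq> i \<Longrightarrow> lam_part d $ j = 0 \<and> eta_part d $ j = 0 \<or>
      a * lam_part z $ j < eta_part z $ j \<and> b * lam_part z $ j < eta_part z $ j \<and> lam_part d $ j = 0 \<or>
      eta_part z $ j < a * lam_part z $ j \<and> eta_part z $ j < b * lam_part z $ j \<and> eta_part d $ j = 0"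
  shows "\<mu> * a \<le> J'' z d d"
proof -
  define l where "l j = lam_part z $ j" for j
  define e where "e j = eta_part z $ j" for j
  \<comment> \<open>The exact increment of \<open>dgap a b\<close> along \<open>d\<close> for small
    positive \<open>s\<close>.\<close>
  define q where "q s = (e i - a * l i) * s - a / 2 * s\<^sup>2" for s
  have part: "lam_part (z + s *\<^sub>R d) $ j = l j + s * lam_part d $ j"
    "eta_part (z + s *\<^sub>R d) $ j = e j + s * eta_part d $ j" for s j
    by (simp_all add: l_def e_def lam_part_def eta_part_def)
  have ev_i: "\<forall>\<^sub>F s in at_right 0. dgap1 a b (l i + s) (e i) - dgap1 a b (l i) (e i) = q s"
  proof -
    have lim: "((\<lambda>s. c * (l i + s)) \<longlongrightarrow> c * (l i + 0)) (at_right 0)" for c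
      by (intro tendsto_intros)
    have "\<forall>\<^sub>F s in at_right 0. a * (l i + s) < e i" "\<forall>\<^sub>F s in at_right 0. e i < b * (l i + s)"
      using i by (intro order_tendstoD[OF lim]; simp add: l_def e_def)+
    then show ?thesis
    proof eventually_elim
      case (elim s)
      have "dgap1 a b (l i) (e i) = e i * l i - a / 2 * (l i)\<^sup>2 - (e i)\<^sup>2 / (2 * b)"
        using i by (intro dgap1_eq_pos ab) (auto simp: l_def e_def)
      moreover have "dgap1 a b (l i + s) (e i) = e i * (l i + s) - a / 2 * (l i + s)\<^sup>2 - (e i)\<^sup>2 / (2 * b)"
        using elim by (intro dgap1_eq_pos ab) auto
      ultimately show ?case by (simp add: q_def power2_eq_square algebra_simps)
    qed
  qed
  have "\<forall>\<^sub>F s in at_right 0. \<forall>j\<in>UNIV. dgap1 a b (l j + s * lam_part d $ j) (e j + s * eta_part d $ j)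
      - dgap1 a b (l j) (e j) = (if j = i then q s else 0)"
  proof (rule eventually_ball_finite, simp, rule ballI)
    fix j
    show "\<forall>\<^sub>F s in at_right 0. dgap1 a b (l j + s * lam_part d $ j) (e j + s * eta_part d $ j)
      - dgap1 a b (l j) (e j) = (if j = i then q s else 0)"
    proof (cases "j = i")
      case True
      then show ?thesis using ev_i i by simp
    next
      case False
      then show ?thesis
        using dgap1_locally_const(1)[OF ab others[OF False]] by (simp add: l_def e_def)
    qed
  qed
  then have ev: "\<forall>\<^sub>F s in at_right 0. dgap a b (z + s *\<^sub>R d) - dgap a b z = q s"
  proof eventually_elim
    case (elim s)
    have "dgap a b (z + s *\<^sub>R d) - dgap a b z = (\<Sum>j\<in>UNIV. if j = i then q s else 0)"
      using elim by (simp add: dgap_eq_sum[OF ab] part flip: sum_subtractf) (simp add: l_def e_def)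
    then show ?case by simp
  qed
  define G where "G d = (\<Sum>j\<in>UNIV. dgap_l a b (l j) (e j) * lam_part d $ j
    + dgap_e a b (l j) (e j) * eta_part d $ j)" for d :: "('x, 'l) zvec"
  have G: "(dgap a b has_derivative G) (at z)"
    using has_derivative_dgap[OF ab, of z] by (simp add: G_def[abs_def] l_def e_def)
  have "G d = (\<Sum>j\<in>UNIV. if j = i then e i - a * l i else 0)"
    unfolding G_def
    using dgap1_locally_const(2)[OF ab others] i dgap1_eq_pos(2)[OF ab, of "l i" "e i"]
    by (intro sum.cong refl) (auto simp: l_def e_def)
  then have Gd: "G d = e i - a * l i" by simp
  have der: "((\<lambda>y. J y + \<mu> * dgap a b y) has_derivative (\<lambda>d. J' z d + \<mu> * G d)) (at z)"
    by (intro has_derivative_add J' has_derivative_mult_right G)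
  obtain u where "grad J z + \<mu> *\<^sub>R grad (dgap a b) z + u v* jacobian h (at z) = 0"
    using stat by (auto simp: gap_stationary_def)
  \<comment> \<open>Pairing the stationarity equation with \<open>d\<close> eliminates the
    multiplier \<open>u\<close>, because \<open>d\<close> lies in the kernel of the Jacobian of
    \<open>h\<close>.\<close>
  then have "(grad J z + \<mu> *\<^sub>R grad (dgap a b) z + u v* jacobian h (at z)) \<bullet> d = 0" by simp
  then have F0: "J' z d + \<mu> * G d = 0"
    by (simp add: inner_add_left grad_inner[OF J'] grad_inner[OF G] dot_lmul_matrix hd)
  have "((\<lambda>s. (J (z + s *\<^sub>R d) - J z - s * J' z d) / s\<^sup>2 - \<mu> * a / 2) \<longlongrightarrow> J'' z d d / 2 - \<mu> * a / 2) (at_right 0)"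
    by (intro tendsto_intros second_difference_quotient J' J'' cont)
  moreover have "\<forall>\<^sub>F s in at_right 0. (J (z + s *\<^sub>R d) - J z - s * J' z d) / s\<^sup>2 - \<mu> * a / 2
      = ((J (z + s *\<^sub>R d) + \<mu> * dgap a b (z + s *\<^sub>R d)) - (J z + \<mu> * dgap a b z)) / s\<^sup>2"
    using ev eventually_at_right_less[of "0::real"]
  proof eventually_elim
    case (elim s)
    have J'd: "J' z d = - (\<mu> * (e i - a * l i))" using F0 Gd by simp
    have "\<mu> * q s = - (s * J' z d) - \<mu> * a / 2 * s\<^sup>2"
      unfolding J'd q_def by (simp add: algebra_simps)
    moreover have "dgap a b (z + s *\<^sub>R d) = dgap a b z + q s" using elim(1) by simp
    ultimately have num: "(J (z + s *\<^sub>R d) + \<mu> * dgap a b (z + s *\<^sub>R d)) - (J z + \<mu> * dgap a b z)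
        = (J (z + s *\<^sub>R d) - J z - s * J' z d) - \<mu> * a / 2 * s\<^sup>2"
      by (simp add: ring_distribs)
    show ?case unfolding num using elim(2) by (simp add: diff_divide_distrib)
  qed
  ultimately have "((\<lambda>s. ((J (z + s *\<^sub>R d) + \<mu> * dgap a b (z + s *\<^sub>R d)) - (J z + \<mu> * dgap a b z)) / s\<^sup>2)
      \<longlongrightarrow> J'' z d d / 2 - \<mu> * a / 2) (at_right 0)"
    by (rule Lim_transform_eventually)
  then have "dir_deriv2 (\<lambda>y. J y + \<mu> * dgap a b y) z d d = J'' z d d / 2 - \<mu> * a / 2"
    by (rule dir_deriv2_stationary[OF der F0])
  moreover have "dir_deriv2 (\<lambda>y. J y + \<mu> * dgap a b y) z d d \<ge> 0"
    using so hd by (simp add: gap_second_order_def)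
  ultimately show ?thesis by simp
qed

section \<open>Passage to the limit: feasibility, multipliers and their signs\<close>

lemma tendsto_lam_eta_part:
  assumes "(Z \<longlongrightarrow> z) F"
  shows "((\<lambda>k. lam_part (Z k) $ i) \<longlongrightarrow> lam_part z $ i) F" "((\<lambda>k. eta_part (Z k) $ i) \<longlongrightarrow> eta_part z $ i) F"
  using assms by (simp_all add: lam_part_def eta_part_def tendsto_vec_nth)

text \<open>Dividing the bound on the penalized objective by \<open>m k\<close> forces the D-gap
  values to a nonpositive limit. Being nonnegative, the D-gap function vanishes at \<open>z\<close>,
  and its zeros are complementary.\<close>

lemma mpcc_feasible_limit:
  fixes z :: "('x::finite, 'l::finite) zvec"
  assumes ab: "0 < a" "a < b" and Z: "Z \<longlonglongrightarrow> z"
    and cont: "isCont J z" "isCont h z" and h0: "\<And>k. h (Z k) = 0"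
    and m: "filterlim m at_top sequentially"
    and bd: "\<And>k. \<bar>J (Z k) + m k * dgap a b (Z k)\<bar> \<le> M"
  shows "mpcc_feasible h z"
proof -
  have "isCont (dgap a b) z"
    by (rule has_derivative_continuous[OF has_derivative_dgap[OF ab]])
  then have g: "(\<lambda>k. dgap a b (Z k)) \<longlonglongrightarrow> dgap a b z"
    using Z by (rule isCont_tendsto_compose)
  have JZ: "(\<lambda>k. J (Z k)) \<longlonglongrightarrow> J z"
    using cont(1) Z by (rule isCont_tendsto_compose)
  have "(\<lambda>k. (M - J (Z k)) * inverse (m k)) \<longlonglongrightarrow> (M - J z) * 0"
    by (intro tendsto_intros JZ tendsto_inverse_0_at_top m)
  moreover have "\<forall>\<^sub>F k in sequentially. dgap a b (Z k) \<le> (M - J (Z k)) * inverse (m k)"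
    using filterlim_at_top_dense[THEN iffD1, OF m, rule_format, of 0]
  proof eventually_elim
    case (elim k)
    with bd[of k] show ?case by (simp add: field_simps)
  qed
  ultimately have "dgap a b z \<le> 0"
    using tendsto_le[OF _ _ g] by fastforce
  then have "dgap a b z = 0" using dgap_nonneg[OF ab, of z] by simp
  note zero = dgap_eq_0D[OF ab this]
  have "(\<lambda>k. h (Z k)) \<longlonglongrightarrow> h z"
    using cont(2) Z by (rule isCont_tendsto_compose)
  then have "h z = 0" by (simp add: h0 LIMSEQ_const_iff)
  moreover have "lam_part z \<bullet> eta_part z = 0"
    unfolding inner_vec_def inner_real_def zero by simp
  ultimately show ?thesis
    using zero(1,2) by (simp add: mpcc_feasible_def)
qed

lemma LC2E:
  assumes "LC2 f"
  obtains f' f'' where "\<And>z. (f has_derivative blinfun_apply (f' z)) (at z)"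
    "\<And>z. (f' has_derivative blinfun_apply (f'' z)) (at z)" "continuous_on UNIV f''"
  using assms lipschitz_on_continuous_on unfolding LC2_def by blast

theorem theorem3:
  fixes J :: "('x::finite, 'l::finite) zvec \<Rightarrow> real"
    and h :: "('x, 'l) zvec \<Rightarrow> real ^ 'h"
    and a b :: real
    and \<mu> :: "nat \<Rightarrow> real"
    and z :: "nat \<Rightarrow> ('x, 'l) zvec"
    and zbar :: "('x, 'l) zvec"
  assumes "LC2 J" and "LC2 h"
    and "0 < a" and "a < b"
    and "\<And>k. \<mu> k > 0" and "filterlim \<mu> at_top sequentially"
    and "\<And>k. gap_stationary a b J h (\<mu> k) (z k)"
    and "\<And>k. gap_second_order a b J h (\<mu> k) (z k)"
    and "\<exists>r::nat \<Rightarrow> nat. strict_mono r \<and> (z \<circ> r) \<longlonglongrightarrow> zbar"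
    and "\<exists>M. \<forall>k. \<bar>J (z k) + \<mu> k * dgap a b (z k)\<bar> \<le> M"
    and "MPCC_LICQ h zbar"
    and "ULSC J h zbar"
  shows "strongly_stationary J h zbar"
proof -
  note ab = assms(3,4)
  obtain r :: "nat \<Rightarrow> nat" where r: "strict_mono r" "(z \<circ> r) \<longlonglongrightarrow> zbar" using assms(9) by blast
  define Z where "Z k = z (r k)" for k
  define m where "m k = \<mu> (r k)" for k
  have Z: "Z \<longlonglongrightarrow> zbar" using r(2) by (simp add: Z_def[abs_def] o_def)
  have m: "filterlim m at_top sequentially"
    using filterlim_compose[OF assms(6) filterlim_subseq[OF r(1)]] by (simp add: m_def[abs_def])
  have m_pos: "m k > 0" for k by (simp add: m_def assms(5))
  have stat: "gap_stationary a b J h (m k) (Z k)" and so: "gap_second_order a b J h (m k) (Z k)" for k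
    by (simp_all add: m_def Z_def assms(7,8))
  obtain M where M: "\<bar>J (Z k) + m k * dgap a b (Z k)\<bar> \<le> M" for k
    using assms(10) by (auto simp: Z_def m_def)
  obtain J' J'' where J': "\<And>z. (J has_derivative blinfun_apply (J' z)) (at z)"
    and J'': "\<And>z. (J' has_derivative blinfun_apply (J'' z)) (at z)" and contJ: "continuous_on UNIV J''"
    by (rule LC2E[OF assms(1)], rule that)
  obtain h' h'' where h': "\<And>z. (h has_derivative blinfun_apply (h' z)) (at z)"
    and h'': "\<And>z. (h' has_derivative blinfun_apply (h'' z)) (at z)" and "continuous_on UNIV h''"
    by (rule LC2E[OF assms(2)], rule that)
  have J'Z: "(\<lambda>k. J' (Z k)) \<longlonglongrightarrow> J' zbar"
    using has_derivative_continuous[OF J''] Z by (rule isCont_tendsto_compose)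
  have h'Z: "(\<lambda>k. h' (Z k)) \<longlonglongrightarrow> h' zbar"
    using has_derivative_continuous[OF h''] Z by (rule isCont_tendsto_compose)
  have J''Z: "(\<lambda>k. J'' (Z k)) \<longlonglongrightarrow> J'' zbar"
    using continuous_on_tendsto_compose[OF contJ Z] by simp
  have gJ: "(\<lambda>k. grad J (Z k)) \<longlonglongrightarrow> grad J zbar"
    using tendsto_grad[OF J' J'Z] .
  have feas: "mpcc_feasible h zbar"
    using mpcc_feasible_limit[OF ab Z has_derivative_continuous[OF J'] has_derivative_continuous[OF h'] _ m M]
      stat by (simp add: gap_stationary_def)
  have "\<forall>i\<in>UNIV. lam_part zbar $ i * eta_part zbar $ i = 0"
    using feas by (subst sum_nonneg_eq_0_iff[symmetric]) (auto simp: mpcc_feasible_def inner_vec_def)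
  then have compl: "i \<in> I_lam zbar \<or> i \<in> I_eta zbar \<or> i \<in> I_lam_eta zbar" for i
    using feas by (auto simp: mpcc_feasible_def I_lam_def I_eta_def I_lam_eta_def less_le)
  define l where "l k i = lam_part (Z k) $ i" for k i
  define e where "e k i = eta_part (Z k) $ i" for k i
  have lim_le: "(\<lambda>k. c * l k i - e k i) \<longlonglongrightarrow> c * lam_part zbar $ i - eta_part zbar $ i" for c i
    unfolding l_def e_def by (intro tendsto_intros tendsto_lam_eta_part Z)
  \<comment> \<open>The limit of \<open>c * l k i - e k i\<close> is negative on
    \<open>I_lam zbar\<close> and, for positive \<open>c\<close>, positive on
    \<open>I_eta zbar\<close>. The iterates therefore end up in the regions where
    \<open>dgap_e\<close> and \<open>dgap_l\<close>, respectively, vanish.\<close>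
  have ev_lam: "\<forall>\<^sub>F k in sequentially. \<forall>i\<in>I_lam zbar. a * l k i < e k i \<and> b * l k i < e k i"
  proof (intro eventually_ball_finite ballI)
    fix i assume "i \<in> I_lam zbar"
    then have "\<forall>\<^sub>F k in sequentially. c * l k i - e k i < 0" for c
      by (intro order_tendstoD(2)[OF lim_le]) (simp add: I_lam_def)
    from eventually_conj[OF this[of a] this[of b]]
    show "\<forall>\<^sub>F k in sequentially. a * l k i < e k i \<and> b * l k i < e k i" by simp
  qed simp
  have ev_eta: "\<forall>\<^sub>F k in sequentially. \<forall>i\<in>I_eta zbar. e k i < a * l k i \<and> e k i < b * l k i"
  proof (intro eventually_ball_finite ballI)
    fix i assume "i \<in> I_eta zbar"
    then have "\<forall>\<^sub>F k in sequentially. c * l k i - e k i > 0" if "c > 0" for c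
      using that by (intro order_tendstoD(1)[OF lim_le]) (simp add: I_eta_def)
    from eventually_conj[OF this[of a] this[of b]]
    show "\<forall>\<^sub>F k in sequentially. e k i < a * l k i \<and> e k i < b * l k i" using ab by simp
  qed simp
  define A :: "('h + 'l + 'l) set"
    where "A = UNIV <+> ((I_lam zbar \<union> I_lam_eta zbar) <+> (I_eta zbar \<union> I_lam_eta zbar))"
  have A_mem: "Inl t \<in> A" "Inr (Inl i) \<in> A \<longleftrightarrow> i \<in> I_lam zbar \<or> i \<in> I_lam_eta zbar"
    "Inr (Inr i) \<in> A \<longleftrightarrow> i \<in> I_eta zbar \<or> i \<in> I_lam_eta zbar" for t i
    by (auto simp: A_def)
  \<comment> \<open>By complementarity, the indices outside \<open>A\<close> are those whose
    coefficients weak stationarity sets to zero.\<close>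
  have notin_A: "(\<exists>i\<in>I_eta zbar. s = Inr (Inl i)) \<or> (\<exists>i\<in>I_lam zbar. s = Inr (Inr i))"
    if "s \<notin> A" for s
  proof (cases s)
    case (Inl t)
    then show ?thesis using that by (simp add: A_mem)
  next
    case (Inr t)
    then show ?thesis
    proof (cases t)
      case (Inl i)
      then show ?thesis using \<open>s = Inr t\<close> that compl[of i] by (auto simp: A_mem)
    next
      case (Inr i)
      then show ?thesis using \<open>s = Inr t\<close> that compl[of i] by (auto simp: A_mem)
    qed
  qed
  have row_lim: "(\<lambda>k. active_row h (Z k) s) \<longlonglongrightarrow> active_row h zbar s" for s
  proof (cases s)
    case (Inr t)
    then show ?thesis by (cases t) simp_all
  qed (simp add: tendsto_row_jacobian[OF h' h'Z])
  obtain D D0 where D: "\<And>j. j \<in> A \<Longrightarrow> (\<lambda>k. D k j) \<longlonglongrightarrow> D0 j"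
    and D_dual: "\<forall>\<^sub>F k in sequentially. \<forall>i\<in>A. \<forall>j\<in>A. active_row h (Z k) i \<bullet> D k j = (if i = j then 1 else 0)"
    and D0_dual: "\<And>i j. i \<in> A \<Longrightarrow> j \<in> A \<Longrightarrow> active_row h zbar i \<bullet> D0 j = (if i = j then 1 else 0)"
    using tendsto_dual_family[where A = A and g = "\<lambda>k. active_row h (Z k)" and F = sequentially, OF row_lim]
      assms(11) unfolding MPCC_LICQ_def Let_def A_def[symmetric] by blast
  obtain u v w where uvw: "weak_multipliers J h zbar u v w"
    and vw: "\<And>i. i \<in> I_lam_eta zbar \<Longrightarrow> v $ i * w $ i \<noteq> 0"
    using assms(12) by (auto simp: ULSC_def)
  have v: "v $ i = 0" if "i \<in> I_eta zbar" for i using uvw that by (simp add: weak_multipliers_def)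
  have w: "w $ i = 0" if "i \<in> I_lam zbar" for i using uvw that by (simp add: weak_multipliers_def)
  \<comment> \<open>The signs of \<open>v\<close> and \<open>w\<close> are reversed because weak
    stationarity subtracts these terms, whereas the penalty gradient is added.\<close>
  define y0 where "y0 = case_sum (($) u) (case_sum (\<lambda>i. - v $ i) (\<lambda>i. - w $ i))"
  have y0: "y0 j = - grad J zbar \<bullet> D0 j" if "j \<in> A" for j
  proof (rule coefficient_eq_inner_dual[OF _ _ _ that])
    show "(\<Sum>s\<in>UNIV. y0 s *\<^sub>R active_row h zbar s) = - grad J zbar"
      using weak_multipliersD[OF uvw] by (simp add: y0_def)
    show "y0 s = 0" if "s \<notin> A" for s
      using notin_A[OF that] v w by (auto simp: y0_def)
  qed (use D0_dual in auto)
  define p where "p k i = m k * dgap_l a b (l k i) (e k i)" for k i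
  define q where "q k i = m k * dgap_e a b (l k i) (e k i)" for k i
  have "\<exists>u. (\<Sum>s\<in>UNIV. case_sum (($) u) (case_sum (p k) (q k)) s *\<^sub>R active_row h (Z k) s)
      = - grad J (Z k)" for k
    using gap_stationary_multipliers[OF ab stat[of k]] unfolding p_def[abs_def] q_def[abs_def] l_def e_def .
  from choice[OF allI[OF this]]
  obtain U where U: "\<forall>k. (\<Sum>s\<in>UNIV. case_sum (($) (U k)) (case_sum (p k) (q k)) s *\<^sub>R active_row h (Z k) s)
      = - grad J (Z k)" ..
  \<comment> \<open>For large \<open>k\<close> the iterate's coefficients also vanish outside
    \<open>A\<close>, so both sides are given by the same dual formula. Its ingredients converge,
    hence so do the multipliers.\<close>
  have y_lim: "(\<lambda>k. case_sum (($) (U k)) (case_sum (p k) (q k)) j) \<longlonglongrightarrow> y0 j" if "j \<in> A" for j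
  proof -
    have "(\<lambda>k. - grad J (Z k) \<bullet> D k j) \<longlonglongrightarrow> y0 j"
      unfolding y0[OF that] by (intro tendsto_intros gJ D that)
    moreover have "\<forall>\<^sub>F k in sequentially.
        - grad J (Z k) \<bullet> D k j = case_sum (($) (U k)) (case_sum (p k) (q k)) j"
      using D_dual ev_lam ev_eta
    proof eventually_elim
      case (elim k)
      have p0: "p k i = 0" if "i \<in> I_eta zbar" for i
        using elim(3) that by (auto simp: p_def less_imp_le intro!: dgap1_eq_right(2)[OF ab])
      have q0: "q k i = 0" if "i \<in> I_lam zbar" for i
        using elim(2) that by (auto simp: q_def intro!: dgap1_eq_left(2)[OF ab])
      show ?case
      proof (rule coefficient_eq_inner_dual[OF U[rule_format] _ elim(1) that, symmetric])
        show "case_sum (($) (U k)) (case_sum (p k) (q k)) s = 0" if "s \<notin> A" for s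
          using notin_A[OF that] p0 q0 by auto
      qed
    qed
    ultimately show ?thesis by (rule Lim_transform_eventually)
  qed
  \<comment> \<open>The multipliers supplied by \<open>ULSC\<close> are themselves the ones shown to
    be strong.\<close>
  have "0 \<le> v $ i \<and> 0 \<le> w $ i" if i: "i \<in> I_lam_eta zbar" for i
  proof -
    have p_lim: "(\<lambda>k. p k i) \<longlonglongrightarrow> - v $ i" and q_lim: "(\<lambda>k. q k i) \<longlonglongrightarrow> - w $ i"
      using y_lim[of "Inr (Inl i)"] y_lim[of "Inr (Inr i)"] i by (auto simp: A_mem y0_def)
    have ev_pq: "\<forall>\<^sub>F k in sequentially. p k i \<noteq> 0" "\<forall>\<^sub>F k in sequentially. q k i \<noteq> 0"
      using vw[OF i] by (auto intro: tendsto_imp_eventually_ne[OF p_lim] tendsto_imp_eventually_ne[OF q_lim])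
    have iA: "Inr (Inl i) \<in> A" using i by (simp add: A_mem)
    \<comment> \<open>Orthogonal to every active gradient except that of \<open>\<lambda>\<^sub>i\<close>, and convergent, so that the
      curvature of \<open>J\<close> along it stays bounded.\<close>
    define d where "d k = D k (Inr (Inl i))" for k
    have "(\<lambda>k. J'' (Z k) (d k) (d k)) \<longlonglongrightarrow> J'' zbar (D0 (Inr (Inl i))) (D0 (Inr (Inl i)))"
      unfolding d_def by (intro tendsto_intros J''Z D iA)
    then have "\<forall>\<^sub>F k in sequentially. J'' (Z k) (d k) (d k) < J'' zbar (D0 (Inr (Inl i))) (D0 (Inr (Inl i))) + 1"
      by (rule order_tendstoD) simp
    \<comment> \<open>The curvature of \<open>J\<close> stays below its limit plus 1, and
      \<open>m k * a\<close> eventually exceeds that bound.\<close>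
    moreover have "\<forall>\<^sub>F k in sequentially. m k > (J'' zbar (D0 (Inr (Inl i))) (D0 (Inr (Inl i))) + 1) / a"
      using m by (simp add: filterlim_at_top_dense)
    ultimately have ev_curv: "\<forall>\<^sub>F k in sequentially. J'' (Z k) (d k) (d k) < m k * a"
      by eventually_elim (use ab in \<open>simp add: field_simps\<close>)
    have "\<forall>\<^sub>F k in sequentially. p k i \<le> 0 \<and> q k i \<le> 0"
      using ev_pq ev_curv D_dual ev_lam ev_eta
    proof eventually_elim
      case (elim k)
      have lp: "dgap_l a b (l k i) (e k i) \<noteq> 0" and eq: "dgap_e a b (l k i) (e k i) \<noteq> 0"
        using elim(1,2) by (auto simp: p_def q_def)
      have dual: "active_row h (Z k) s \<bullet> d k = (if s = Inr (Inl i) then 1 else 0)" if "s \<in> A" for s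
        using elim(4) that iA by (simp add: d_def)
      \<comment> \<open>Duality leaves the \<lambda>-part of \<open>d k\<close> undetermined on
        \<open>I_eta zbar\<close>, and the \<eta>-part on \<open>I_lam zbar\<close>. This is
        harmless, since there the D-gap term does not depend locally on that variable.\<close>
      have dl: "lam_part (d k) $ j = (if j = i then 1 else 0)" if "j \<notin> I_eta zbar" for j
      proof -
        have "Inr (Inl j) \<in> A" using that compl[of j] by (auto simp: A_mem)
        from dual[OF this] show ?thesis by (simp add: lam_part_def inner_axis')
      qed
      have de: "eta_part (d k) $ j = 0" if "j \<notin> I_lam zbar" for j
      proof -
        have "Inr (Inr j) \<in> A" using that compl[of j] by (auto simp: A_mem)
        from dual[OF this] show ?thesis by (simp add: eta_part_def inner_axis')
      qed
      have "row t (jacobian h (at (Z k))) \<bullet> d k = 0" for t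
        using dual[OF A_mem(1)[of t]] by simp
      then have hd: "jacobian h (at (Z k)) *v d k = 0"
        by (simp add: vec_eq_iff matrix_vector_mult_def row_def inner_vec_def)
      have i': "i \<notin> I_eta zbar" "i \<notin> I_lam zbar"
        using i by (auto simp: I_lam_eta_def I_lam_def I_eta_def)
      have "\<not> (a * l k i < e k i \<and> e k i < b * l k i)"
      proof
        assume "a * l k i < e k i \<and> e k i < b * l k i"
        then have "m k * a \<le> J'' (Z k) (d k) (d k)"
        proof (intro second_order_curvature_bound[OF J' J'' contJ ab stat so hd, of i])
          fix j assume "j \<noteq> i"
          then show "lam_part (d k) $ j = 0 \<and> eta_part (d k) $ j = 0 \<or>
            a * lam_part (Z k) $ j < eta_part (Z k) $ j \<and> b * lam_part (Z k) $ j < eta_part (Z k) $ j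
              \<and> lam_part (d k) $ j = 0 \<or>
            eta_part (Z k) $ j < a * lam_part (Z k) $ j \<and> eta_part (Z k) $ j < b * lam_part (Z k) $ j
              \<and> eta_part (d k) $ j = 0"
            using compl[of j] elim(5,6) dl[of j] de[of j]
            by (auto simp: l_def e_def I_lam_def I_eta_def I_lam_eta_def)
        qed (use dl de i' in \<open>auto simp: l_def e_def\<close>)
        with elim(3) show False by simp
      qed
      \<comment> \<open>On this boundary ray \<open>dgap_e\<close> is
        \<open>l k i - e k i / b = 0\<close>, contrary to \<open>eq\<close>. The two regions in
        which one partial derivative vanishes are excluded by \<open>lp\<close> and
        \<open>eq\<close> too, so only the region of \<open>dgap1_eq_neg\<close> remains.\<close>
      moreover have "e k i \<noteq> b * l k i" if "a * l k i < e k i"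
        using eq that ab by (auto simp: dgap_e_def)
      ultimately have "b * l k i < e k i" "e k i \<le> a * l k i"
        using lp eq dgap1_eq_left(2)[OF ab, of "l k i" "e k i"] dgap1_eq_right(2)[OF ab, of "e k i" "l k i"]
        by force+
      note neg = this
      have "e k i / a - l k i \<le> 0" using neg ab by (simp add: field_simps)
      then show ?case
        using neg m_pos[of k] by (auto simp: p_def q_def dgap1_eq_neg[OF ab neg] mult_le_0_iff)
    qed
    then have ev: "\<forall>\<^sub>F k in sequentially. p k i \<le> 0" "\<forall>\<^sub>F k in sequentially. q k i \<le> 0"
      by (simp_all add: eventually_conj_iff)
    have "- v $ i \<le> 0" "- w $ i \<le> 0"
      by (rule tendsto_upperbound[OF p_lim ev(1)] tendsto_upperbound[OF q_lim ev(2)], simp)+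
    then show ?thesis by simp
  qed
  then show ?thesis using feas uvw by (auto simp: strongly_stationary_def)
qed

end
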